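(* Let $n\ge 1$, let $\Omega\subset\mathbb{R}^n$ be open and bounded, $s\in(0,1)$, let $G$ be a Young function satisfying $(G_1)$, $(G_2)$, $(G_3)$, and let $\alpha>0$. Let $\{\lambda_{k,\alpha}^D\}_{k\in\mathbb{N}}$, $\{c_{k,\alpha}^D\}_{k\in\mathbb{N}}$ be the Ljusternik–Schnirelman Dirichlet eigenvalues and critical values at level $\alpha$, and let $\{\Lambda_{k,\alpha}^D\}_{k\in\mathbb{N}}$, $\{C_{k,\alpha}^D\}_{k\in\mathbb{N}}$ be the minimax Dirichlet eigenvalues and critical values at level $\alpha$ (as defined in the context). Then for every $k\in\mathbb{N}$ $$\frac{\alpha p^-}{p^+}\le c_{k,\alpha}^D\cdot\lambda_{k,\alpha}^D\le\frac{\alpha p^+}{p^-},\qquad \frac{p^-}{\alpha p^+}\le\frac{\Lambda_{k,\alpha}^D}{C_{k,\alpha}^D}\le\frac{p^+}{\alpha p^-},$$ where $p^\pm$ are the numbers in $(G_1)$.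
   Context: Young function: $G(t)=\int_0^t g(\tau)\,d\tau$ for $t\ge0$, where $g:[0,\infty)\to[0,\infty)$ is right continuous, $g(0)=0$, $g(t)>0$ for $t>0$, $g$ is non-decreasing on $(0,\infty)$, and $\lim_{t\to\infty}g(t)=\infty$. Structural conditions: $(G_1)$ there are constants $p^-,p^+$ with $1<p^-\le \frac{tg(t)}{G(t)}\le p^+<\infty$ for all $t>0$; $(G_2)$ $t\mapsto G(\sqrt t)$, $t\in[0,\infty)$, is convex; $(G_3)$ $\int_0^1 \frac{G^{-1}(\tau)}{\tau^{(n+s)/n}}\,d\tau<\infty$ and $\int_1^{\infty}\frac{G^{-1}(\tau)}{\tau^{(n+s)/n}}\,d\tau=\infty$. Notation: $D_su(x,y)=\frac{u(x)-u(y)}{|x-y|^s}$, $d\mu=\frac{dx\,dy}{|x-y|^n}$; $g(|t|)\frac{t}{|t|}$ is read as $0$ at $t=0$. Functionals: $\mathcal{I}(u)=\int_\Omega G(|u|)\,dx$, $\mathcal{J}(u)=\iint_{\mathbb{R}^n\times\mathbb{R}^n}G(|D_su|)\,d\mu$. Space: $W^{s,G}_0(\Omega)=\{u:\mathbb{R}^n\to\mathbb{R}\text{ measurable}: \int_{\mathbb{R}^n}G(|u|)\,dx<\infty,\ \mathcal{J}(u)<\infty,\ u=0\text{ a.e. in }\mathbb{R}^n\setminus\Omega\}$, normed by $\|u\|_{L^G(\Omega)}+[u]_{W^{s,G}(\mathbb{R}^n)}$, where $\|u\|_{L^G(\Omega)}=\inf\{\lambda>0:\mathcal{I}(u/\lambda)\le1\}$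 and $[u]_{W^{s,G}(\mathbb{R}^n)}=\inf\{\lambda>0:\mathcal{J}(u/\lambda)\le1\}$. $\lambda\in\mathbb{R}$ is an eigenvalue of the Dirichlet problem $D(\Omega)$ with eigenfunction $u\in W^{s,G}_0(\Omega)$, $u\ne0$, if $$\iint_{\mathbb{R}^n\times\mathbb{R}^n}g(|D_su|)\frac{D_su}{|D_su|}D_sv\,d\mu=\lambda\int_\Omega g(|u|)\frac{u}{|u|}v\,dx\qquad\forall v\in W^{s,G}_0(\Omega).$$ Ljusternik–Schnirelman sequences at level $\alpha$: $c_{k,\alpha}^D=\sup_{K\in\mathcal{C}_k^D}\inf_{u\in K}\mathcal{I}(u)$, where $\mathcal{C}_k^D$ is the family of compact symmetric $K\subset\{u\in W^{s,G}_0(\Omega):\mathcal{J}(u)=\alpha\}$ with $\mathcal{I}>0$ on $K$ and $\gamma(K)\ge k$, with $\gamma(K)=\inf\{p\in\mathbb{N}:\exists\,h:K\to\mathbb{R}^p\setminus\{0\}\text{ continuous and odd}\}$ the Krasnoselskii genus; $\lambda_{k,\alpha}^D$ is an eigenvalue of $D(\Omega)$ having an eigenfunction $u$ with $\mathcal{J}(u)=\alpha$ and $\mathcal{I}(u)=c_{k,\alpha}^D$. Minimax sequences at level $\alpha$: $C_{k,\alpha}^D=\inf_{h}\sup_{w\in S^{k-1}}\mathcal{J}(h(w))$, the infimum over odd continuous $h:S^{k-1}\to\{u\in W^{s,G}_0(\Omega):\mathcal{I}(u)=\alpha\}$, $S^{k-1}$ the unit sphere of $\mathbb{R}^k$; $\Lambda_{k,\alpha}^D$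 is an eigenvalue of $D(\Omega)$ having an eigenfunction $v$ with $\mathcal{I}(v)=\alpha$ and $\mathcal{J}(v)=C_{k,\alpha}^D$. *)

theory Defs
  imports "HOL-Analysis.Analysis"
begin

section \<open>Young functions\<close>

text \<open>Only the values of \<open>g\<close> and \<open>G\<close> on \<open>[0,\<infinity>)\<close> are used.\<close>

definition young_density :: "(real \<Rightarrow> real) \<Rightarrow> bool" where
  "young_density g \<longleftrightarrow>
     (\<forall>t\<ge>0. continuous (at_right t) g) \<and> g 0 = 0 \<and> (\<forall>t>0. g t > 0) \<and>
     mono_on {0<..} g \<and> filterlim g at_top at_top"

definition young :: "(real \<Rightarrow> real) \<Rightarrow> real \<Rightarrow> real" where
  "young g t = integral {0..t} g"

definition G1 :: "(real \<Rightarrow> real) \<Rightarrow> real \<Rightarrow> real \<Rightarrow> bool" where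
  "G1 g pm pp \<longleftrightarrow>
     1 < pm \<and> (\<forall>t>0. pm \<le> t * g t / young g t \<and> t * g t / young g t \<le> pp)"

definition G2 :: "(real \<Rightarrow> real) \<Rightarrow> bool" where
  "G2 g \<longleftrightarrow> convex_on {0..} (\<lambda>t. young g (sqrt t))"

definition young_inv :: "(real \<Rightarrow> real) \<Rightarrow> real \<Rightarrow> real" where
  "young_inv g = inv_into {0..} (young g)"

definition G3 :: "nat \<Rightarrow> real \<Rightarrow> (real \<Rightarrow> real) \<Rightarrow> bool" where
  "G3 n s g \<longleftrightarrow>
     (\<integral>\<^sup>+\<tau>\<in>{0..1}. ennreal (young_inv g \<tau> / \<tau> powr ((real n + s) / real n)) \<partial>lborel) < \<infinity> \<and>
     (\<integral>\<^sup>+\<tau>\<in>{1..}. ennreal (young_inv g \<tau> / \<tau> powr ((real n + s) / real n)) \<partial>lborel) = \<infinity>"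

section \<open>Functionals\<close>

definition Ds :: "real \<Rightarrow> (real^'n \<Rightarrow> real) \<Rightarrow> (real^'n) \<times> (real^'n) \<Rightarrow> real" where
  "Ds s u = (\<lambda>(x, y). (u x - u y) / norm (x - y) powr s)"

text \<open>On the diagonal, a null set, the density below takes the value \<open>1 / 0 = 0\<close>.\<close>

definition mu :: "((real^'n) \<times> (real^'n)) measure" where
  "mu = density (lebesgue \<Otimes>\<^sub>M lebesgue)
          (\<lambda>(x, y). ennreal (1 / norm (x - y) ^ CARD('n)))"

definition Ifun :: "(real \<Rightarrow> real) \<Rightarrow> (real^'n) set \<Rightarrow> (real^'n \<Rightarrow> real) \<Rightarrow> ennreal" where
  "Ifun g \<Omega> u = (\<integral>\<^sup>+x\<in>\<Omega>. ennreal (young g \<bar>u x\<bar>) \<partial>lebesgue)"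

definition Jfun :: "(real \<Rightarrow> real) \<Rightarrow> real \<Rightarrow> (real^'n \<Rightarrow> real) \<Rightarrow> ennreal" where
  "Jfun g s u = (\<integral>\<^sup>+z. ennreal (young g \<bar>Ds s u z\<bar>) \<partial>mu)"

section \<open>The space and its topology\<close>

text \<open>Elements are functions, with equality almost everywhere as equality of elements: the norm
  of the space is a seminorm on functions that vanishes exactly on the null functions, and
  \<open>W0_top\<close> is the (non-Hausdorff) topology that it induces.\<close>

definition W0 :: "(real \<Rightarrow> real) \<Rightarrow> real \<Rightarrow> (real^'n) set \<Rightarrow> (real^'n \<Rightarrow> real) set" where
  "W0 g s \<Omega> = {u. u \<in> borel_measurable lebesgue \<and>
                   (\<integral>\<^sup>+x. ennreal (young g \<bar>u x\<bar>) \<partial>lebesgue) < \<infinity> \<and>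
                   Jfun g s u < \<infinity> \<and>
                   (AE x in lebesgue. x \<notin> \<Omega> \<longrightarrow> u x = 0)}"

definition W0_norm :: "(real \<Rightarrow> real) \<Rightarrow> real \<Rightarrow> (real^'n) set \<Rightarrow> (real^'n \<Rightarrow> real) \<Rightarrow> real" where
  "W0_norm g s \<Omega> u =
     Inf {l. l > 0 \<and> Ifun g \<Omega> (\<lambda>x. u x / l) \<le> 1} + Inf {l. l > 0 \<and> Jfun g s (\<lambda>x. u x / l) \<le> 1}"

definition W0_top :: "(real \<Rightarrow> real) \<Rightarrow> real \<Rightarrow> (real^'n) set \<Rightarrow> (real^'n \<Rightarrow> real) topology" where
  "W0_top g s \<Omega> = topology (\<lambda>U. U \<subseteq> W0 g s \<Omega> \<and>
     (\<forall>u\<in>U. \<exists>e>0. \<forall>v\<in>W0 g s \<Omega>. W0_norm g s \<Omega> (\<lambda>x. v x - u x) < e \<longrightarrow> v \<in> U))"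

lemma openin_W0_top:
  "openin (W0_top g s \<Omega>) U \<longleftrightarrow> U \<subseteq> W0 g s \<Omega> \<and>
     (\<forall>u\<in>U. \<exists>e>0. \<forall>v\<in>W0 g s \<Omega>. W0_norm g s \<Omega> (\<lambda>x. v x - u x) < e \<longrightarrow> v \<in> U)"
proof -
  let ?P = "\<lambda>U. U \<subseteq> W0 g s \<Omega> \<and>
     (\<forall>u\<in>U. \<exists>e>0. \<forall>v\<in>W0 g s \<Omega>. W0_norm g s \<Omega> (\<lambda>x. v x - u x) < e \<longrightarrow> v \<in> U)"
  have "istopology ?P"
    unfolding istopology_def
  proof (intro conjI allI impI)
    fix S T assume S: "?P S" and T: "?P T"
    show "S \<inter> T \<subseteq> W0 g s \<Omega>" using S by blast
    show "\<forall>u\<in>S \<inter> T. \<exists>e>0. \<forall>v\<in>W0 g s \<Omega>. W0_norm g s \<Omega> (\<lambda>x. v x - u x) < e \<longrightarrow> v \<in> S \<inter> T"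
    proof
      fix u assume "u \<in> S \<inter> T"
      then obtain d e where "d > 0" "e > 0"
        "\<forall>v\<in>W0 g s \<Omega>. W0_norm g s \<Omega> (\<lambda>x. v x - u x) < d \<longrightarrow> v \<in> S"
        "\<forall>v\<in>W0 g s \<Omega>. W0_norm g s \<Omega> (\<lambda>x. v x - u x) < e \<longrightarrow> v \<in> T"
        using S T by blast
      then show "\<exists>e>0. \<forall>v\<in>W0 g s \<Omega>. W0_norm g s \<Omega> (\<lambda>x. v x - u x) < e \<longrightarrow> v \<in> S \<inter> T"
        by (intro exI[of _ "min d e"]) auto
    qed
  next
    fix \<K> assume K: "\<forall>S\<in>\<K>. ?P S"
    show "\<Union>\<K> \<subseteq> W0 g s \<Omega>" using K by blast
    show "\<forall>u\<in>\<Union>\<K>. \<exists>e>0. \<forall>v\<in>W0 g s \<Omega>. W0_norm g s \<Omega> (\<lambda>x. v x - u x) < e \<longrightarrow> v \<in> \<Union>\<K>"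
    proof
      fix u assume "u \<in> \<Union>\<K>"
      then obtain S where S: "S \<in> \<K>" "u \<in> S" by blast
      then obtain e where "e > 0"
        "\<forall>v\<in>W0 g s \<Omega>. W0_norm g s \<Omega> (\<lambda>x. v x - u x) < e \<longrightarrow> v \<in> S"
        using K by blast
      then show "\<exists>e>0. \<forall>v\<in>W0 g s \<Omega>. W0_norm g s \<Omega> (\<lambda>x. v x - u x) < e \<longrightarrow> v \<in> \<Union>\<K>"
        using S by blast
    qed
  qed
  then show ?thesis
    unfolding W0_top_def by (simp add: topology_inverse')
qed

lemma topspace_W0_top [simp]: "topspace (W0_top g s \<Omega>) = W0 g s \<Omega>"
proof -
  have "openin (W0_top g s \<Omega>) (W0 g s \<Omega>)"
    unfolding openin_W0_top by (auto intro: exI[of _ 1])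
  moreover have "topspace (W0_top g s \<Omega>) \<subseteq> W0 g s \<Omega>"
    using openin_topspace[of "W0_top g s \<Omega>"] unfolding openin_W0_top by blast
  ultimately show ?thesis
    using openin_subset by blast
qed

section \<open>Eigenvalues\<close>

definition gsgn :: "(real \<Rightarrow> real) \<Rightarrow> real \<Rightarrow> real" where
  "gsgn g t = g \<bar>t\<bar> * (t / \<bar>t\<bar>)"

text \<open>Under \<open>G1\<close> both integrands below are integrable for all \<open>u\<close> and \<open>v\<close> in \<open>W0\<close>, since
  \<open>g \<bar>a\<bar> * \<bar>b\<bar> \<le> pp * (young g \<bar>a\<bar> + young g \<bar>b\<bar>)\<close>; so the value \<open>0\<close> that the
  Bochner integral assigns to a non-integrable function plays no role.\<close>

definition eigenpair ::
  "(real \<Rightarrow> real) \<Rightarrow> real \<Rightarrow> (real^'n) set \<Rightarrow> real \<Rightarrow> (real^'n \<Rightarrow> real) \<Rightarrow> bool" where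
  "eigenpair g s \<Omega> l u \<longleftrightarrow>
     u \<in> W0 g s \<Omega> \<and> \<not> (AE x in lebesgue. u x = 0) \<and>
     (\<forall>v\<in>W0 g s \<Omega>.
        (LINT z|mu. gsgn g (Ds s u z) * Ds s v z) = l * (LINT x:\<Omega>|lebesgue. gsgn g (u x) * v x))"

section \<open>Ljusternik-Schnirelman values\<close>

text \<open>The natural number \<open>p\<close> may be \<open>0\<close>, in which case the target of \<open>h\<close> is empty: thus the empty
  set has genus \<open>0\<close>, and any other set has positive genus. Elements of the Euclidean space
  of dimension \<open>p\<close> are functions on \<open>nat\<close> that vanish from \<open>p\<close> on. A continuous \<open>h\<close> is constant on
  classes of functions that are equal almost everywhere.\<close>

definition genus ::
  "(real \<Rightarrow> real) \<Rightarrow> real \<Rightarrow> (real^'n) set \<Rightarrow> (real^'n \<Rightarrow> real) set \<Rightarrow> enat" where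
  "genus g s \<Omega> K = Inf {enat p |p. \<exists>h.
     continuous_map (subtopology (W0_top g s \<Omega>) K)
       (subtopology (Euclidean_space p) (- {\<lambda>_. 0})) h \<and>
     (\<forall>u\<in>K. h (\<lambda>x. - u x) = (\<lambda>i. - h u i))}"

definition LS_family ::
  "(real \<Rightarrow> real) \<Rightarrow> real \<Rightarrow> (real^'n) set \<Rightarrow> real \<Rightarrow> nat \<Rightarrow> (real^'n \<Rightarrow> real) set set" where
  "LS_family g s \<Omega> \<alpha> k = {K.
     K \<subseteq> {u \<in> W0 g s \<Omega>. Jfun g s u = ennreal \<alpha>} \<and>
     compactin (W0_top g s \<Omega>) K \<and>
     (\<forall>u\<in>K. (\<lambda>x. - u x) \<in> K) \<and>
     (\<forall>u\<in>K. Ifun g \<Omega> u > 0) \<and>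
     genus g s \<Omega> K \<ge> enat k}"

definition LS_value ::
  "(real \<Rightarrow> real) \<Rightarrow> real \<Rightarrow> (real^'n) set \<Rightarrow> real \<Rightarrow> nat \<Rightarrow> ennreal" where
  "LS_value g s \<Omega> \<alpha> k = (SUP K\<in>LS_family g s \<Omega> \<alpha> k. INF u\<in>K. Ifun g \<Omega> u)"

definition LS_eigenvalue ::
  "(real \<Rightarrow> real) \<Rightarrow> real \<Rightarrow> (real^'n) set \<Rightarrow> real \<Rightarrow> nat \<Rightarrow> real \<Rightarrow> bool" where
  "LS_eigenvalue g s \<Omega> \<alpha> k l \<longleftrightarrow>
     (\<exists>u. eigenpair g s \<Omega> l u \<and> Jfun g s u = ennreal \<alpha> \<and> Ifun g \<Omega> u = LS_value g s \<Omega> \<alpha> k)"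

section \<open>Minimax values\<close>

text \<open>For \<open>k \<ge> 1\<close> the unit sphere of the \<open>k\<close>-dimensional space is \<open>nsphere (k - 1)\<close>. Oddness of
  \<open>h\<close> is an equality in \<open>W0\<close>, hence almost everywhere.\<close>

definition minimax_maps ::
  "(real \<Rightarrow> real) \<Rightarrow> real \<Rightarrow> (real^'n) set \<Rightarrow> real \<Rightarrow> nat \<Rightarrow> ((nat \<Rightarrow> real) \<Rightarrow> real^'n \<Rightarrow> real) set" where
  "minimax_maps g s \<Omega> \<alpha> k = {h.
     continuous_map (nsphere (k - 1))
       (subtopology (W0_top g s \<Omega>) {u. Ifun g \<Omega> u = ennreal \<alpha>}) h \<and>
     (\<forall>w\<in>topspace (nsphere (k - 1)). AE x in lebesgue. h (\<lambda>i. - w i) x = - h w x)}"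

definition minimax_value ::
  "(real \<Rightarrow> real) \<Rightarrow> real \<Rightarrow> (real^'n) set \<Rightarrow> real \<Rightarrow> nat \<Rightarrow> ennreal" where
  "minimax_value g s \<Omega> \<alpha> k =
     (INF h\<in>minimax_maps g s \<Omega> \<alpha> k. SUP w\<in>topspace (nsphere (k - 1)). Jfun g s (h w))"

definition minimax_eigenvalue ::
  "(real \<Rightarrow> real) \<Rightarrow> real \<Rightarrow> (real^'n) set \<Rightarrow> real \<Rightarrow> nat \<Rightarrow> real \<Rightarrow> bool" where
  "minimax_eigenvalue g s \<Omega> \<alpha> k l \<longleftrightarrow>
     (\<exists>v. eigenpair g s \<Omega> l v \<and> Ifun g \<Omega> v = ennreal \<alpha> \<and> Jfun g s v = minimax_value g s \<Omega> \<alpha> k)"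

end

theory Submission
  imports Defs
begin

text \<open>Testing the weak equation of an eigenpair \<open>(l, u)\<close> with \<open>u\<close> itself gives \<open>A = l * B\<close>, where,
  by \<open>G1\<close>, \<open>A\<close> lies between \<open>pm * J u\<close> and \<open>pp * J u\<close>, and \<open>B\<close> between \<open>pm * I u\<close> and \<open>pp * I u\<close>.
  Division is possible because \<open>I\<close> and \<open>J\<close> are positive at a nonzero element of the space: if
  \<open>J u = 0\<close>, then \<open>u\<close> is constant almost everywhere, and it vanishes off the bounded set \<open>\<Omega>\<close>.\<close>

section \<open>Monotonicity and measurability of the density and its primitive\<close>

lemma young_density_mono_on:
  assumes "young_density g"
  shows "mono_on {0..} g"
proof (rule mono_onI)
  fix x y :: real
  assume "x \<in> {0..}" "y \<in> {0..}" "x \<le> y"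
  then show "g x \<le> g y"
    using assms unfolding young_density_def mono_on_def
    by (cases "x = 0"; cases "y = 0") (auto simp: less_le)
qed

lemma young_density_nonneg:
  assumes "young_density g" "0 \<le> t"
  shows "0 \<le> g t"
  using assms unfolding young_density_def by (cases "t = 0") (auto simp: less_le)

lemma young_density_integrable_on:
  assumes "young_density g"
  shows "g integrable_on {0..t}"
  by (rule integrable_on_mono_on)
    (use young_density_mono_on[OF assms] in \<open>auto intro: monotone_on_subset\<close>)

lemma young_nonneg:
  assumes "young_density g"
  shows "0 \<le> young g t"
  unfolding young_def
  by (rule integral_nonneg[OF young_density_integrable_on[OF assms]])
    (use young_density_nonneg[OF assms] in auto)

lemma young_0 [simp]: "young g 0 = 0"
  unfolding young_def by simp

text \<open>For negative \<open>t\<close> the interval \<open>{0..t}\<close> is empty, so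
  \<open>young g\<close> is monotone on the whole line, which is what Borel measurability is deduced
  from.\<close>

lemma mono_young:
  assumes "young_density g"
  shows "mono (young g)"
  unfolding young_def
  by (intro monoI integral_subset_le young_density_integrable_on[OF assms])
    (use young_density_nonneg[OF assms] in auto)

lemma young_measurable:
  assumes "young_density g"
  shows "young g \<in> borel_measurable borel"
  by (rule borel_measurable_mono[OF mono_young[OF assms]])

lemma gsgn_measurable:
  assumes "young_density g"
  shows "gsgn g \<in> borel_measurable borel"
proof -
  \<comment> \<open>Nothing is known about \<open>g\<close> on negative numbers. Composing with
    \<open>max 0\<close> gives a function monotone on the whole line, and \<open>gsgn g\<close>
    evaluates \<open>g\<close> only at absolute values.\<close>
  have "mono (\<lambda>t. g (max 0 t))"
    using young_density_mono_on[OF assms] by (auto intro!: monoI elim!: mono_onD)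
  then have [measurable]: "(\<lambda>t. g (max 0 t)) \<in> borel_measurable borel"
    by (rule borel_measurable_mono)
  have "(\<lambda>t::real. g (max 0 \<bar>t\<bar>) * (t / \<bar>t\<bar>)) \<in> borel_measurable borel"
    by measurable
  moreover have "gsgn g = (\<lambda>t. g (max 0 \<bar>t\<bar>) * (t / \<bar>t\<bar>))"
    by (auto simp: gsgn_def)
  ultimately show ?thesis by simp
qed

section \<open>Pointwise and integrated consequences of \<open>G1\<close>\<close>

lemma G1_pos:
  assumes "G1 g pm pp"
  shows "0 < pm" "0 < pp"
  using assms unfolding G1_def by (auto dest: spec[of _ 1])

lemma young_pos:
  assumes "young_density g" "G1 g pm pp" "0 < t"
  shows "0 < young g t"
proof -
  \<comment> \<open>If the denominator were 0, the quotient in \<open>G1\<close> would be 0,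
    contradicting \<open>1 < pm\<close>.\<close>
  have "young g t \<noteq> 0"
    using assms(2,3) unfolding G1_def by fastforce
  then show ?thesis
    using young_nonneg[OF assms(1), of t] by simp
qed

lemma young_abs_eq_0_iff:
  assumes "young_density g" "G1 g pm pp"
  shows "young g \<bar>t\<bar> = 0 \<longleftrightarrow> t = 0"
  using young_pos[OF assms, of "\<bar>t\<bar>"] by (cases "t = 0") auto

text \<open>For \<open>t \<noteq> 0\<close> the product is the numerator of the quotient in
  \<open>G1\<close> at the absolute value of \<open>t\<close>; at 0 all terms vanish.\<close>

lemma gsgn_mult_self_bounds:
  assumes "young_density g" "G1 g pm pp"
  shows "pm * young g \<bar>t\<bar> \<le> gsgn g t * t" "gsgn g t * t \<le> pp * young g \<bar>t\<bar>"
proof -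
  have "pm * young g \<bar>t\<bar> \<le> gsgn g t * t \<and> gsgn g t * t \<le> pp * young g \<bar>t\<bar>"
  proof (cases "t = 0")
    case False
    then have "0 < \<bar>t\<bar>" by simp
    then have "pm \<le> \<bar>t\<bar> * g \<bar>t\<bar> / young g \<bar>t\<bar>" "\<bar>t\<bar> * g \<bar>t\<bar> / young g \<bar>t\<bar> \<le> pp"
      using assms(2) unfolding G1_def by blast+
    moreover have "gsgn g t * t = \<bar>t\<bar> * g \<bar>t\<bar>"
      using False by (simp add: gsgn_def abs_if)
    ultimately show ?thesis
      using young_pos[OF assms \<open>0 < \<bar>t\<bar>\<close>] by (simp add: field_simps)
  qed (simp add: gsgn_def)
  then show "pm * young g \<bar>t\<bar> \<le> gsgn g t * t" "gsgn g t * t \<le> pp * young g \<bar>t\<bar>"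
    by auto
qed

lemma integral_gsgn_mult_self_bounds:
  assumes g: "young_density g" "G1 g pm pp"
    and f[measurable]: "f \<in> borel_measurable M"
    and j: "(\<integral>\<^sup>+x. ennreal (young g \<bar>f x\<bar>) \<partial>M) = ennreal j" "0 \<le> j"
  shows "pm * j \<le> (LINT x|M. gsgn g (f x) * f x)" "(LINT x|M. gsgn g (f x) * f x) \<le> pp * j"
proof -
  note [measurable] = young_measurable[OF g(1)] gsgn_measurable[OF g(1)]
  note bounds = gsgn_mult_self_bounds[OF g]
  have Y: "integrable M (\<lambda>x. young g \<bar>f x\<bar>)" "(LINT x|M. young g \<bar>f x\<bar>) = j"
    using nn_integral_eq_integrable[of "\<lambda>x. young g \<bar>f x\<bar>" M j] j young_nonneg[OF g(1)] by auto
  \<comment> \<open>The pointwise upper bound dominates the integrand; the lower bound makes the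
    integrand nonnegative, so it equals its own norm.\<close>
  have P: "integrable M (\<lambda>x. gsgn g (f x) * f x)"
  proof (rule Bochner_Integration.integrable_bound)
    show "integrable M (\<lambda>x. pp * young g \<bar>f x\<bar>)" using Y by simp
    show "AE x in M. norm (gsgn g (f x) * f x) \<le> norm (pp * young g \<bar>f x\<bar>)"
    proof (rule AE_I2)
      fix x
      have "0 \<le> pm * young g \<bar>f x\<bar>"
        using G1_pos[OF g(2)] young_nonneg[OF g(1)] by simp
      then show "norm (gsgn g (f x) * f x) \<le> norm (pp * young g \<bar>f x\<bar>)"
        using bounds[of "f x"] by simp
    qed
  qed measurable
  have "(LINT x|M. pm * young g \<bar>f x\<bar>) \<le> (LINT x|M. gsgn g (f x) * f x)"
    by (rule integral_mono) (use Y P bounds in auto)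
  then show "pm * j \<le> (LINT x|M. gsgn g (f x) * f x)" using Y by simp
  have "(LINT x|M. gsgn g (f x) * f x) \<le> (LINT x|M. pp * young g \<bar>f x\<bar>)"
    by (rule integral_mono) (use Y P bounds in auto)
  then show "(LINT x|M. gsgn g (f x) * f x) \<le> pp * j" using Y by simp
qed

section \<open>Almost everywhere statements for products of Lebesgue measures\<close>

lemma norm_diff_measurable_lebesgue_pair [measurable]:
  "(\<lambda>z. norm (fst z - snd z)) \<in>
    borel_measurable (lebesgue \<Otimes>\<^sub>M (lebesgue :: 'a::euclidean_space measure))"
proof -
  have id: "(\<lambda>x::'a. x) \<in> borel_measurable lebesgue"
    by (intro measurable_completion) simp
  have "fst \<in> borel_measurable ((lebesgue :: 'a measure) \<Otimes>\<^sub>M (lebesgue :: 'a measure))"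
    "snd \<in> borel_measurable ((lebesgue :: 'a measure) \<Otimes>\<^sub>M (lebesgue :: 'a measure))"
    by (rule measurable_compose[OF measurable_fst id] measurable_compose[OF measurable_snd id])+
  then show ?thesis by measurable
qed

lemma Ds_measurable:
  fixes u :: "real^'n \<Rightarrow> real"
  assumes [measurable]: "u \<in> borel_measurable lebesgue"
  shows "Ds s u \<in> borel_measurable (lebesgue \<Otimes>\<^sub>M lebesgue)"
  unfolding Ds_def case_prod_beta by measurable

lemma measurable_mu:
  "f \<in> borel_measurable (lebesgue \<Otimes>\<^sub>M lebesgue) \<Longrightarrow> f \<in> borel_measurable mu"
  unfolding mu_def by simp

text \<open>Off the diagonal the density of \<open>mu\<close> is positive and the divisor in
  \<open>Ds\<close> is nonzero; on the diagonal the conclusion is trivial.\<close>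

lemma AE_mu_Ds_eq_0D:
  fixes u :: "real^'n \<Rightarrow> real"
  assumes "AE z in mu. Ds s u z = 0"
  shows "AE z in lebesgue \<Otimes>\<^sub>M lebesgue. u (fst z) = u (snd z)"
proof -
  have "AE z in lebesgue \<Otimes>\<^sub>M (lebesgue :: (real^'n) measure).
      0 < ennreal (1 / norm (fst z - snd z) ^ CARD('n)) \<longrightarrow> Ds s u z = 0"
    using assms unfolding mu_def case_prod_beta by (subst (asm) AE_density) auto
  then show ?thesis
  proof eventually_elim
    case (elim z)
    then show ?case
      by (cases "fst z = snd z") (auto simp: Ds_def case_prod_beta)
  qed
qed

text \<open>A countable cover by sets of finite measure keeps its measures in the completion.
  Applied to \<open>lborel\<close>, this allows slicing in the product of Lebesgue measures.\<close>

lemma sigma_finite_completion: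
  assumes "sigma_finite_measure M"
  shows "sigma_finite_measure (completion M)"
proof -
  obtain A where "countable A" "A \<subseteq> sets M" "\<Union>A = space M" "\<forall>a\<in>A. emeasure M a \<noteq> \<infinity>"
    using sigma_finite_measure.sigma_finite_countable[OF assms] by blast
  then show ?thesis
    by (intro sigma_finite_measure.intro exI[of _ A]) (auto simp: subset_eq)
qed

lemma AE_lebesgue_not_bounded:
  fixes S :: "'a::euclidean_space set"
  assumes "bounded S"
  shows "\<not> (AE x in lebesgue. x \<in> S)"
proof
  assume *: "AE x in lebesgue. x \<in> S"
  \<comment> \<open>The ball stands in for \<open>S\<close>, which need not be measurable; the whole
    space would then have the finite measure of the ball.\<close>
  obtain r where r: "S \<subseteq> cball 0 r"
    using assms by (auto simp: bounded_iff subset_eq)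
  have "AE x in lebesgue. x \<in> UNIV \<longleftrightarrow> x \<in> cball (0::'a) r"
    using * by eventually_elim (use r in auto)
  then have "emeasure lebesgue (UNIV::'a set) = emeasure lebesgue (cball (0::'a) r)"
    by (rule emeasure_eq_AE) auto
  also have "\<dots> < \<infinity>"
    using emeasure_bounded_finite[of "cball (0::'a) r"] by simp
  finally show False by (simp add: emeasure_lborel_UNIV)
qed

text \<open>By slicing, for almost every \<open>x\<close> the value \<open>u x\<close> is attained
  at almost every \<open>y\<close>. If it were nonzero, almost every \<open>y\<close> would lie in
  the bounded set \<open>S\<close>.\<close>

lemma AE_const_on_lebesgue_pair_eq_0:
  fixes u :: "'a::euclidean_space \<Rightarrow> real"
  assumes "AE z in lebesgue \<Otimes>\<^sub>M lebesgue. u (fst z) = u (snd z)"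
    and "AE x in lebesgue. x \<notin> S \<longrightarrow> u x = 0" and "bounded S"
  shows "AE x in lebesgue. u x = 0"
proof -
  have sf: "sigma_finite_measure (lebesgue :: 'a measure)"
    by (rule sigma_finite_completion) (rule sigma_finite_lborel)
  interpret pair_sigma_finite "lebesgue :: 'a measure" "lebesgue :: 'a measure"
    by (rule pair_sigma_finite.intro[OF sf sf])
  have "AE x in lebesgue. AE y in lebesgue. u x = u y"
    using AE_pair[OF assms(1)] by simp
  then show ?thesis
  proof eventually_elim
    case (elim x)
    with assms(2) have E: "AE y in lebesgue. y \<notin> S \<longrightarrow> u x = 0"
      by eventually_elim simp
    show ?case
    proof (rule ccontr)
      assume "u x \<noteq> 0"
      with E have "AE y in lebesgue. y \<in> S" by simp
      with AE_lebesgue_not_bounded[OF \<open>bounded S\<close>] show False ..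
    qed
  qed
qed

section \<open>Positivity and finiteness of the functionals\<close>

lemma Jfun_pos:
  fixes u :: "real^'n \<Rightarrow> real"
  assumes "young_density g" "G1 g pm pp" "bounded \<Omega>" "u \<in> W0 g s \<Omega>"
    and nz: "\<not> (AE x in lebesgue. u x = 0)"
  shows "0 < Jfun g s u"
proof (rule ccontr)
  assume "\<not> 0 < Jfun g s u"
  then have J0: "Jfun g s u = 0" by simp
  note [measurable] = young_measurable[OF assms(1)]
  have u: "u \<in> borel_measurable lebesgue" "AE x in lebesgue. x \<notin> \<Omega> \<longrightarrow> u x = 0"
    using assms(4) by (auto simp: W0_def)
  have [measurable]: "Ds s u \<in> borel_measurable mu"
    by (rule measurable_mu[OF Ds_measurable[OF u(1)]])
  have "AE z in mu. ennreal (young g \<bar>Ds s u z\<bar>) = 0"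
    using J0 unfolding Jfun_def by (subst (asm) nn_integral_0_iff_AE) auto
  then have "AE z in mu. Ds s u z = 0"
    using young_nonneg[OF assms(1)] young_abs_eq_0_iff[OF assms(1,2)]
    by (auto simp: ennreal_eq_0_iff order_antisym_conv)
  then show False
    using AE_const_on_lebesgue_pair_eq_0[OF AE_mu_Ds_eq_0D u(2) assms(3)] nz by blast
qed

text \<open>Since \<open>young g 0 = 0\<close>, the indicator can move inside the argument. The
  integrated bounds, stated over a whole measure space, then apply to \<Omega>.\<close>

lemma Ifun_eq_nn_integral:
  "Ifun g \<Omega> u = (\<integral>\<^sup>+x. ennreal (young g \<bar>indicator \<Omega> x * u x\<bar>) \<partial>lebesgue)"
  unfolding Ifun_def by (rule nn_integral_cong) (auto simp: indicator_def)

lemma Ifun_pos: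
  fixes u :: "real^'n \<Rightarrow> real"
  assumes "young_density g" "G1 g pm pp" "open \<Omega>" "u \<in> W0 g s \<Omega>"
    and nz: "\<not> (AE x in lebesgue. u x = 0)"
  shows "0 < Ifun g \<Omega> u"
proof (rule ccontr)
  assume "\<not> 0 < Ifun g \<Omega> u"
  then have I0: "Ifun g \<Omega> u = 0" by simp
  note [measurable] = young_measurable[OF assms(1)]
  have u[measurable]: "u \<in> borel_measurable lebesgue" "AE x in lebesgue. x \<notin> \<Omega> \<longrightarrow> u x = 0"
    using assms(4) by (auto simp: W0_def)
  have [measurable]: "\<Omega> \<in> sets lebesgue" using assms(3) by simp
  have "AE x in lebesgue. ennreal (young g \<bar>indicator \<Omega> x * u x\<bar>) = 0"
    using I0 unfolding Ifun_eq_nn_integral by (subst (asm) nn_integral_0_iff_AE) auto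
  then have "AE x in lebesgue. indicator \<Omega> x * u x = 0"
    using young_nonneg[OF assms(1)] young_abs_eq_0_iff[OF assms(1,2)]
    by (auto simp: ennreal_eq_0_iff order_antisym_conv)
  with u(2) have "AE x in lebesgue. u x = 0"
    by eventually_elim (auto simp: indicator_def split: if_splits)
  with nz show False ..
qed

lemma Ifun_finite:
  assumes "u \<in> W0 g s \<Omega>"
  shows "Ifun g \<Omega> u < \<infinity>"
proof -
  have "Ifun g \<Omega> u \<le> (\<integral>\<^sup>+x. ennreal (young g \<bar>u x\<bar>) \<partial>lebesgue)"
    unfolding Ifun_def by (rule nn_integral_mono) (auto simp: indicator_def)
  also have "\<dots> < \<infinity>" using assms by (simp add: W0_def)
  finally show ?thesis .
qed

section \<open>From the tested equation to the bounds on the eigenvalue\<close>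

lemma ratio_bounds:
  fixes l i j pm pp :: real
  assumes "0 < i" "0 < j" "0 < pm" "0 < pp"
    and "pm * j \<le> l * B" "l * B \<le> pp * j" "pm * i \<le> B" "B \<le> pp * i"
  shows "pm * j / pp \<le> l * i" "l * i \<le> pp * j / pm"
proof -
  \<comment> \<open>The sign of \<open>l\<close> is not given: it follows from \<open>B > 0\<close>
    and \<open>l * B > 0\<close>, and then the bounds on \<open>B\<close> may be multiplied by
    \<open>l\<close>.\<close>
  have "0 < B" using assms(1,3,7) by (meson less_le_trans mult_pos_pos)
  moreover have "0 < l * B" using assms(2,3,5) by (meson less_le_trans mult_pos_pos)
  ultimately have "0 < l" by (simp add: zero_less_mult_iff)
  then have "l * B \<le> l * (pp * i)" "l * (pm * i) \<le> l * B"
    using assms(7,8) by (auto intro: mult_left_mono)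
  with assms(3-6) show "pm * j / pp \<le> l * i" "l * i \<le> pp * j / pm"
    by (auto simp: field_simps)
qed

lemma eigenpair_bounds:
  fixes \<Omega> :: "(real^'n) set"
  assumes g: "young_density g" "G1 g pm pp" and \<Omega>: "open \<Omega>" "bounded \<Omega>"
    and eig: "eigenpair g s \<Omega> l u"
  defines "i \<equiv> enn2real (Ifun g \<Omega> u)" and "j \<equiv> enn2real (Jfun g s u)"
  shows "0 < i" "0 < j" "pm * j / pp \<le> l * i" "l * i \<le> pp * j / pm"
proof -
  have u: "u \<in> W0 g s \<Omega>" "\<not> (AE x in lebesgue. u x = 0)"
    \<comment> \<open>The weak equation with test function \<open>v = u\<close>.\<close>
    and eq: "(LINT z|mu. gsgn g (Ds s u z) * Ds s u z) = l * (LINT x:\<Omega>|lebesgue. gsgn g (u x) * u x)"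
    using eig by (auto simp: eigenpair_def)
  have um[measurable]: "u \<in> borel_measurable lebesgue" and Jfin: "Jfun g s u < \<infinity>"
    using u by (auto simp: W0_def)
  have [measurable]: "\<Omega> \<in> sets lebesgue" using \<Omega> by simp
  note pos = Ifun_pos[OF g \<Omega>(1) u] Jfun_pos[OF g \<Omega>(2) u]
  show ij: "0 < i" "0 < j"
    \<comment> \<open>Finiteness matters here, because \<open>enn2real\<close> sends infinity to
      0.\<close>
    unfolding i_def j_def enn2real_positive_iff using pos Ifun_finite[OF u(1)] Jfin by auto
  have I: "(\<integral>\<^sup>+x. ennreal (young g \<bar>indicator \<Omega> x * u x\<bar>) \<partial>lebesgue) = ennreal i"
    unfolding i_def Ifun_eq_nn_integral[symmetric] using Ifun_finite[OF u(1)] by simp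
  have J: "(\<integral>\<^sup>+z. ennreal (young g \<bar>Ds s u z\<bar>) \<partial>mu) = ennreal j"
    unfolding j_def Jfun_def[symmetric] using Jfin by simp
  have B: "(LINT x:\<Omega>|lebesgue. gsgn g (u x) * u x) =
      (LINT x|lebesgue. gsgn g (indicator \<Omega> x * u x) * (indicator \<Omega> x * u x))"
    unfolding set_lebesgue_integral_def
    by (rule Bochner_Integration.integral_cong) (auto simp: indicator_def)
  have "(\<lambda>x. indicator \<Omega> x * u x) \<in> borel_measurable lebesgue" by measurable
  note bI = integral_gsgn_mult_self_bounds[OF g this I less_imp_le[OF ij(1)], folded B]
  note bJ = integral_gsgn_mult_self_bounds[OF g measurable_mu[OF Ds_measurable[OF um]] J
      less_imp_le[OF ij(2)], unfolded eq]
  show "pm * j / pp \<le> l * i" "l * i \<le> pp * j / pm"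
    by (rule ratio_bounds[OF ij G1_pos[OF g(2)] bJ bI])+
qed

theorem theorem1p4:
  fixes \<Omega> :: "(real^'n) set" and g :: "real \<Rightarrow> real" and s pm pp \<alpha> :: real
  assumes "open \<Omega>" and "bounded \<Omega>"
    and "0 < s" and "s < 1"
    and "young_density g" and "G1 g pm pp" and "G2 g" and "G3 CARD('n) s g"
    and "\<alpha> > 0"
  shows "\<forall>k\<ge>1.
    (\<forall>l. LS_eigenvalue g s \<Omega> \<alpha> k l \<longrightarrow>
       \<alpha> * pm / pp \<le> enn2real (LS_value g s \<Omega> \<alpha> k) * l \<and>
       enn2real (LS_value g s \<Omega> \<alpha> k) * l \<le> \<alpha> * pp / pm) \<and>
    (\<forall>L. minimax_eigenvalue g s \<Omega> \<alpha> k L \<longrightarrow>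
       pm / (\<alpha> * pp) \<le> L / enn2real (minimax_value g s \<Omega> \<alpha> k) \<and>
       L / enn2real (minimax_value g s \<Omega> \<alpha> k) \<le> pp / (\<alpha> * pm))"
proof (intro allI impI conjI)
  fix k :: nat and l :: real
  assume "LS_eigenvalue g s \<Omega> \<alpha> k l"
  then obtain u where u: "eigenpair g s \<Omega> l u" "Jfun g s u = ennreal \<alpha>"
    "Ifun g \<Omega> u = LS_value g s \<Omega> \<alpha> k"
    unfolding LS_eigenvalue_def by blast
  \<comment> \<open>Here \<open>j\<close> becomes \<alpha> and \<open>i\<close> becomes the critical
    value.\<close>
  note b = eigenpair_bounds[OF assms(5,6,1,2) u(1), unfolded u(2,3)]
  show "\<alpha> * pm / pp \<le> enn2real (LS_value g s \<Omega> \<alpha> k) * l"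
    "enn2real (LS_value g s \<Omega> \<alpha> k) * l \<le> \<alpha> * pp / pm"
    using b(3,4) \<open>\<alpha> > 0\<close> by (simp_all add: mult.commute)
next
  fix k :: nat and L :: real
  assume "minimax_eigenvalue g s \<Omega> \<alpha> k L"
  then obtain v where v: "eigenpair g s \<Omega> L v" "Ifun g \<Omega> v = ennreal \<alpha>"
    "Jfun g s v = minimax_value g s \<Omega> \<alpha> k"
    unfolding minimax_eigenvalue_def by blast
  \<comment> \<open>The roles are exchanged: \<open>i\<close> becomes \<alpha> and \<open>j\<close>
    the critical value, whose positivity \<open>b(2)\<close> permits division by it.\<close>
  note b = eigenpair_bounds[OF assms(5,6,1,2) v(1), unfolded v(2,3)]
  show "pm / (\<alpha> * pp) \<le> L / enn2real (minimax_value g s \<Omega> \<alpha> k)"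
    "L / enn2real (minimax_value g s \<Omega> \<alpha> k) \<le> pp / (\<alpha> * pm)"
    using b(2-4) \<open>\<alpha> > 0\<close> G1_pos[OF assms(6)] by (simp_all add: field_simps)
qed

end
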